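(* Let $S$ be an integral domain, let $R\subset S$ be a subring, and let $G$ be a subgroup of $\mathrm{Aut}(S)$ whose action on $S$ is locally finite and such that $\sigma(R)\subseteq R$ for all $\sigma\in G$. If $S$ is a strong extension of $R$, then $S^G$ is a strong extension of $R^G$.
   Context: All rings are commutative with unity, and subrings share the unity. $\mathrm{Aut}(S)$ is the group of ring automorphisms of $S$. $S^G=\{s\in S : \sigma(s)=s \text{ for all } \sigma\in G\}$ and $R^G=\{r\in R : \sigma(r)=r \text{ for all } \sigma\in G\}=R\cap S^G$. The action of $G$ on $S$ is locally finite if for every $s\in S$ the orbit $\{\sigma(s) : \sigma\in G\}$ is finite. Let $R$ be a subring of an integral domain $S$. A prime ideal $\mathfrak{p}$ of $R$ is called $S$-strong if, for all $x,y\in S$, $xy\in\mathfrak{p}$ implies $x\in\mathfrak{p}$ or $y\in\mathfrak{p}$. If every prime ideal of $R$ is $S$-strong, then $S$ is called a strong extension of $R$. *)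

theory Defs
  imports "HOL-Algebra.Algebra"
begin

text \<open>
  As for the library's \<^const>\<open>auto\<close> and \<^const>\<open>AutoGroup\<close>, automorphisms are extensional functions,
  so that equality of automorphisms is equality of functions and they form a group.
\<close>

definition ring_auto :: "('a, 'b) ring_scheme \<Rightarrow> ('a \<Rightarrow> 'a) set"
  where "ring_auto S = ring_iso S S \<inter> extensional (carrier S)"

definition RingAutoGroup :: "('a, 'b) ring_scheme \<Rightarrow> ('a \<Rightarrow> 'a) monoid"
  where "RingAutoGroup S = BijGroup (carrier S) \<lparr>carrier := ring_auto S\<rparr>"

lemma (in ring) subgroup_ring_auto: "subgroup (ring_auto R) (BijGroup (carrier R))"
proof -
  interpret B: group "BijGroup (carrier R)" by (rule group_BijGroup)
  have sub: "ring_auto R \<subseteq> Bij (carrier R)"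
    by (auto simp: ring_auto_def ring_iso_def Bij_def)
  show ?thesis
  proof (rule B.subgroupI)
    show "ring_auto R \<subseteq> carrier (BijGroup (carrier R))"
      using sub by (simp add: BijGroup_def)
    have "(\<lambda>x\<in>carrier R. x) \<in> ring_auto R"
      using id_Bij[of "carrier R"]
      by (auto simp: ring_auto_def ring_iso_def Bij_def ring_hom_def)
    then show "ring_auto R \<noteq> {}" by blast
  next
    fix f assume f: "f \<in> ring_auto R"
    have iso: "f \<in> ring_iso R R" and bij: "f \<in> Bij (carrier R)"
      using f sub by (auto simp: ring_auto_def)
    have "inv_into (carrier R) f \<in> ring_iso R R"
      using ring_iso_set_sym[OF ring_axioms iso] .
    then have "(\<lambda>x\<in>carrier R. inv_into (carrier R) f x) \<in> ring_iso R R"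
      by (rule ring_iso_restrict) simp
    then show "inv\<^bsub>BijGroup (carrier R)\<^esub> f \<in> ring_auto R"
      by (simp add: inv_BijGroup bij ring_auto_def)
  next
    fix f g assume fg: "f \<in> ring_auto R" "g \<in> ring_auto R"
    have "f \<circ> g \<in> ring_iso R R"
      using fg ring_iso_set_trans[of g R R f R] by (auto simp: ring_auto_def)
    then have "compose (carrier R) f g \<in> ring_iso R R"
      by (rule ring_iso_restrict) (simp add: compose_def)
    moreover have "f \<in> Bij (carrier R)" "g \<in> Bij (carrier R)"
      using fg sub by auto
    ultimately show "f \<otimes>\<^bsub>BijGroup (carrier R)\<^esub> g \<in> ring_auto R"
      by (simp add: BijGroup_def ring_auto_def)
  qed
qed

lemma (in ring) group_RingAutoGroup: "group (RingAutoGroup R)"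
  unfolding RingAutoGroup_def
  by (rule subgroup.subgroup_is_group[OF subgroup_ring_auto group_BijGroup])

definition fixed_points :: "('a \<Rightarrow> 'a) set \<Rightarrow> 'a set \<Rightarrow> 'a set"
  where "fixed_points G A = {a \<in> A. \<forall>\<sigma>\<in>G. \<sigma> a = a}"

definition locally_finite_action :: "('a \<Rightarrow> 'a) set \<Rightarrow> 'a set \<Rightarrow> bool"
  where "locally_finite_action G A \<longleftrightarrow> (\<forall>a\<in>A. finite {\<sigma> a | \<sigma>. \<sigma> \<in> G})"

text \<open>
  Below, a subring \<open>R\<close> of \<open>S\<close> is given by its carrier set; as a ring it is
  \<open>S\<lparr>carrier := R\<rparr>\<close>.
\<close>

definition strong_prime :: "'a set \<Rightarrow> 'a set \<Rightarrow> ('a, 'b) ring_scheme \<Rightarrow> bool"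
  where "strong_prime \<pp> R S \<longleftrightarrow>
    primeideal \<pp> (S\<lparr>carrier := R\<rparr>) \<and>
    (\<forall>x\<in>carrier S. \<forall>y\<in>carrier S. x \<otimes>\<^bsub>S\<^esub> y \<in> \<pp> \<longrightarrow> x \<in> \<pp> \<or> y \<in> \<pp>)"

definition strong_extension :: "'a set \<Rightarrow> ('a, 'b) ring_scheme \<Rightarrow> bool"
  where "strong_extension R S \<longleftrightarrow>
    domain S \<and> subring R S \<and>
    (\<forall>\<pp>. primeideal \<pp> (S\<lparr>carrier := R\<rparr>) \<longrightarrow> strong_prime \<pp> R S)"

end

theory Submission
  imports Defs
begin

text \<open>
  Write \<open>A = R\<^sup>G\<close>, which is \<open>R \<inter> S\<^sup>G\<close>. Let \<open>\<pp>\<close> be a prime of \<open>A\<close>, and suppose that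
  some prime \<open>P\<close> of \<open>R\<close> satisfies \<open>P \<inter> A = \<pp>\<close>. If \<open>x, y \<in> S\<^sup>G\<close> and \<open>xy \<in> \<pp> \<subseteq> P\<close>, then
  one of the factors, say \<open>x\<close>, lies in \<open>P\<close> because \<open>P\<close> is \<open>S\<close>-strong; so \<open>x \<in> R \<inter> S\<^sup>G = A\<close>, and
  therefore \<open>x \<in> P \<inter> A = \<pp>\<close>. The whole difficulty is thus lying over for \<open>A \<subseteq> R\<close>, which is
  lemma \<open>lying_over_fixed_points\<close>.

  Lying over would follow from the integrality of \<open>R\<close> over \<open>A\<close>, but norms give it
  directly. Let \<open>P\<close> be an ideal of \<open>R\<close> maximal among those that miss the multiplicative
  set \<open>A - \<pp>\<close>; it is prime (lemma \<open>exists_prime_avoiding\<close>) and \<open>P \<inter> A \<subseteq> \<pp>\<close>. If some \<open>a \<in> \<pp>\<close>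
  were not in \<open>P\<close>, then \<open>P\<close> and \<open>a\<close> together would generate an element of \<open>A - \<pp>\<close>, so that
  \<open>s + ar \<in> P\<close> for some \<open>s \<in> A - \<pp>\<close> and \<open>r \<in> R\<close>. The product of \<open>s + at\<close> over a finite
  \<open>G\<close>-stable set of elements \<open>t\<close> that contains \<open>r\<close> is \<open>G\<close>-invariant and has a factor in \<open>P\<close>, so
  it lies in \<open>P \<inter> A \<subseteq> \<pp>\<close>. It also has the form \<open>s\<^sup>n + ac\<close> with \<open>c \<in> R\<close>. Here \<open>ac\<close> is invariant and
  \<open>a \<noteq> 0\<close>, so \<open>c\<close> is invariant because \<open>R\<close> is a domain, and \<open>ac \<in> \<pp>\<close>. Hence
  \<open>s\<^sup>n \<in> \<pp>\<close>, contrary to \<open>s \<notin> \<pp>\<close>.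
\<close>

section \<open>Primes avoiding a multiplicative set\<close>

text \<open>
  The usual Zorn argument. The last conclusion records the maximality of \<open>P\<close>,
  which is needed beyond primality: adjoining any further element makes the ideal meet \<open>M\<close>.
\<close>

lemma (in cring) exists_prime_avoiding:
  assumes I: "ideal I R" "I \<inter> M = {}"
    and M: "M \<subseteq> carrier R" "\<one> \<in> M" "\<And>x y. x \<in> M \<Longrightarrow> y \<in> M \<Longrightarrow> x \<otimes> y \<in> M"
  obtains P where "primeideal P R" "I \<subseteq> P" "P \<inter> M = {}"
    "\<And>a. a \<in> carrier R \<Longrightarrow> a \<notin> P \<Longrightarrow> \<exists>q\<in>P. \<exists>r\<in>carrier R. q \<oplus> a \<otimes> r \<in> M"
proof -
  let ?F = "{J. ideal J R \<and> I \<subseteq> J \<and> J \<inter> M = {}}"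
  have "\<exists>P\<in>?F. \<forall>J\<in>?F. P \<subseteq> J \<longrightarrow> J = P"
  proof (rule subset_Zorn_nonempty)
    show "?F \<noteq> {}" using I by blast
  next
    fix C assume C: "C \<noteq> {}" "subset.chain ?F C"
    then have "subset.chain {J. ideal J R} C"
      by (auto simp: pred_on.chain_def)
    from chain_Union_is_ideal[OF this] C(1) have "ideal (\<Union>C) R" by simp
    with C show "\<Union>C \<in> ?F" by (auto simp: pred_on.chain_def)
  qed
  then obtain P where P: "ideal P R" "I \<subseteq> P" "P \<inter> M = {}"
    and max: "\<And>J. ideal J R \<Longrightarrow> J \<inter> M = {} \<Longrightarrow> P \<subseteq> J \<Longrightarrow> J = P"
    by (smt (verit) mem_Collect_eq order_trans)
  interpret P: ideal P R by (fact P(1))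
  have gen: "\<exists>q\<in>P. \<exists>r\<in>carrier R. q \<oplus> a \<otimes> r \<in> M" if a: "a \<in> carrier R" "a \<notin> P" for a
  proof -
    let ?J = "P <+>\<^bsub>R\<^esub> PIdl a"
    have J: "ideal ?J R" using add_ideals[OF P(1) cgenideal_ideal[OF a(1)]] .
    have "p \<in> ?J" if "p \<in> P" for p
    proof -
      have "p \<oplus> \<zero> \<otimes> a \<in> ?J"
        using that by (auto simp: set_add_def' cgenideal_def)
      then show ?thesis using that a P.a_subset by auto
    qed
    then have sub: "P \<subseteq> ?J" by blast
    have "\<zero> \<oplus> \<one> \<otimes> a \<in> ?J"
      using P.zero_closed by (fastforce simp: set_add_def' cgenideal_def)
    then have "a \<in> ?J" using a by simp
    with max[OF J] sub a have "?J \<inter> M \<noteq> {}" by blast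
    then obtain q r where "q \<in> P" "r \<in> carrier R" "q \<oplus> r \<otimes> a \<in> M"
      by (auto simp: set_add_def' cgenideal_def)
    then show ?thesis using a m_comm by metis
  qed
  have "primeideal P R"
  proof (rule primeidealI[OF P(1) is_cring])
    show "carrier R \<noteq> P" using P(3) M(2) by auto
  next
    fix x y assume xy: "x \<in> carrier R" "y \<in> carrier R" "x \<otimes> y \<in> P"
    show "x \<in> P \<or> y \<in> P"
    proof (rule ccontr)
      assume "\<not> (x \<in> P \<or> y \<in> P)"
      with gen xy obtain q r q' r' where
        q: "q \<in> P" "r \<in> carrier R" "q \<oplus> x \<otimes> r \<in> M" and
        q': "q' \<in> P" "r' \<in> carrier R" "q' \<oplus> y \<otimes> r' \<in> M" by metis
      have c: "q \<in> carrier R" "q' \<in> carrier R" using q q' P.a_subset by auto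
      have "(q \<oplus> x \<otimes> r) \<otimes> (q' \<oplus> y \<otimes> r')
          = q \<otimes> (q' \<oplus> y \<otimes> r') \<oplus> ((x \<otimes> r) \<otimes> q' \<oplus> (x \<otimes> y) \<otimes> (r \<otimes> r'))"
        using xy q(2) q'(2) c by algebra
      also have "\<dots> \<in> P"
        using xy q q' c by (simp add: P.I_r_closed P.I_l_closed)
      finally show False using M(3)[OF q(3) q'(3)] P(3) by blast
    qed
  qed
  with P gen show thesis by (intro that)
qed

section \<open>Lying over for rings of invariants\<close>

lemma (in cring) finprod_in_ideal:
  assumes "ideal I R" "finite A" "r \<in> A" "f \<in> A \<rightarrow> carrier R" "f r \<in> I"
  shows "finprod R f A \<in> I"
proof -
  interpret I: ideal I R by fact
  have "finprod R f (insert r (A - {r})) = f r \<otimes> finprod R f (A - {r})"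
    using assms by (intro finprod_insert) auto
  moreover have "insert r (A - {r}) = A" using assms by blast
  ultimately show ?thesis
    using assms by (auto intro!: I.I_r_closed finprod_closed)
qed

lemma (in cring) finprod_add_mult_const:
  assumes "finite A" "A \<subseteq> carrier R" "s \<in> carrier R" "a \<in> carrier R"
  shows "\<exists>c\<in>carrier R. (\<Otimes>t\<in>A. s \<oplus> a \<otimes> t) = s [^] card A \<oplus> a \<otimes> c"
  using assms
proof (induction A rule: finite_induct)
  case empty
  then show ?case by (auto intro!: bexI[of _ \<zero>])
next
  case (insert t A)
  then obtain c where c: "c \<in> carrier R" "(\<Otimes>t\<in>A. s \<oplus> a \<otimes> t) = s [^] card A \<oplus> a \<otimes> c"
    by auto
  have t: "t \<in> carrier R" using insert by simp
  have "(\<Otimes>t\<in>insert t A. s \<oplus> a \<otimes> t) = (s \<oplus> a \<otimes> t) \<otimes> (s [^] card A \<oplus> a \<otimes> c)"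
    using insert c by (subst finprod_insert) auto
  also have "\<dots> = s [^] card A \<otimes> s \<oplus> a \<otimes> (s \<otimes> c \<oplus> t \<otimes> (s [^] card A \<oplus> a \<otimes> c))"
  proof -
    have "s [^] card A \<in> carrier R" using insert by simp
    then show ?thesis using insert.prems t c(1) by algebra
  qed
  finally show ?case
    using insert t c by (intro bexI[of _ "s \<otimes> c \<oplus> t \<otimes> (s [^] card A \<oplus> a \<otimes> c)"]) auto
qed

text \<open>
  An injective map of a finite set into itself is a permutation, so the endomorphism only
  reorders the factors.
\<close>

lemma (in cring) finprod_stable_set_invariant:
  fixes \<sigma> :: "'a \<Rightarrow> 'a"
  assumes \<sigma>: "\<sigma> \<in> ring_hom R R" "inj_on \<sigma> (carrier R)"
    and A: "finite A" "A \<subseteq> carrier R" "\<sigma> ` A \<subseteq> A"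
    and s: "s \<in> carrier R" "\<sigma> s = s" and a: "a \<in> carrier R" "\<sigma> a = a"
  shows "\<sigma> (\<Otimes>t\<in>A. s \<oplus> a \<otimes> t) = (\<Otimes>t\<in>A. s \<oplus> a \<otimes> t)"
proof -
  interpret \<sigma>: ring_hom_cring R R \<sigma>
    using \<sigma>(1) is_cring by (simp add: ring_hom_cring_def ring_hom_cring_axioms_def)
  have inj: "inj_on \<sigma> A" using \<sigma>(2) A(2) by (rule inj_on_subset)
  then have surj: "\<sigma> ` A = A" using A(1,3) by (simp add: endo_inj_surj)
  have "\<sigma> (\<Otimes>t\<in>A. s \<oplus> a \<otimes> t) = (\<Otimes>t\<in>A. s \<oplus> a \<otimes> \<sigma> t)"
  proof -
    have "\<sigma> (\<Otimes>t\<in>A. s \<oplus> a \<otimes> t) = (\<Otimes>t\<in>A. (\<sigma> \<circ> (\<lambda>t. s \<oplus> a \<otimes> t)) t)"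
      using A s a by (subst \<sigma>.hom_finprod) (auto simp: comp_def)
    also have "\<dots> = (\<Otimes>t\<in>A. s \<oplus> a \<otimes> \<sigma> t)"
      using A s a by (intro finprod_cong') (auto simp: subset_iff)
    finally show ?thesis .
  qed
  also have "\<dots> = (\<Otimes>t\<in>\<sigma> ` A. s \<oplus> a \<otimes> t)"
    using A s a inj by (intro finprod_reindex[symmetric]) auto
  finally show ?thesis by (simp only: surj)
qed

lemma (in cring) subring_fixed_points:
  assumes "\<And>\<sigma>. \<sigma> \<in> G \<Longrightarrow> \<sigma> \<in> ring_hom R R"
  shows "subring (fixed_points G (carrier R)) R"
proof (rule subringI)
  have hom: "ring_hom_cring R R \<sigma>" if "\<sigma> \<in> G" for \<sigma>
    using assms[OF that] is_cring by (simp add: ring_hom_cring_def ring_hom_cring_axioms_def)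
  have fixes_elem: "\<sigma> h = h" if "\<sigma> \<in> G" "h \<in> fixed_points G (carrier R)" for \<sigma> h
    using that by (simp add: fixed_points_def)
  have carr: "h \<in> carrier R" if "h \<in> fixed_points G (carrier R)" for h
    using that by (simp add: fixed_points_def)
  have I: "h \<in> fixed_points G (carrier R)" if "h \<in> carrier R" "\<And>\<sigma>. \<sigma> \<in> G \<Longrightarrow> \<sigma> h = h" for h
    using that by (simp add: fixed_points_def)
  show "fixed_points G (carrier R) \<subseteq> carrier R" using carr by blast
  show "\<one> \<in> fixed_points G (carrier R)"
    by (rule I) (auto dest: assms ring_hom_one)
  show "\<ominus> h \<in> fixed_points G (carrier R)" if "h \<in> fixed_points G (carrier R)" for h
    using that by (intro I) (simp_all add: carr fixes_elem ring_hom_cring.hom_a_inv[OF hom])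
  fix h k assume hk: "h \<in> fixed_points G (carrier R)" "k \<in> fixed_points G (carrier R)"
  show "h \<otimes> k \<in> fixed_points G (carrier R)"
    using hk by (intro I) (simp_all add: carr fixes_elem ring_hom_mult[OF assms])
  show "h \<oplus> k \<in> fixed_points G (carrier R)"
    using hk by (intro I) (simp_all add: carr fixes_elem ring_hom_add[OF assms])
qed

text \<open>
  Local finiteness enters as the assumption that every element lies in a finite \<open>G\<close>-stable
  set; this replaces orbits, and \<open>G\<close> may then be any set of injective endomorphisms.
\<close>

lemma (in domain) lying_over_fixed_points:
  assumes hom: "\<And>\<sigma>. \<sigma> \<in> G \<Longrightarrow> \<sigma> \<in> ring_hom R R"
    and inj: "\<And>\<sigma>. \<sigma> \<in> G \<Longrightarrow> inj_on \<sigma> (carrier R)"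
    and fin: "\<And>r. r \<in> carrier R \<Longrightarrow>
      \<exists>A. finite A \<and> A \<subseteq> carrier R \<and> r \<in> A \<and> (\<forall>\<sigma>\<in>G. \<sigma> ` A \<subseteq> A)"
    and \<pp>: "primeideal \<pp> (R\<lparr>carrier := fixed_points G (carrier R)\<rparr>)"
  obtains P where "primeideal P R" "P \<inter> fixed_points G (carrier R) = \<pp>"
proof -
  define F where "F = fixed_points G (carrier R)"
  have F: "subring F R" unfolding F_def by (rule subring_fixed_points) (rule hom)
  note Fsub = subringE(1)[OF F]
  interpret F: domain "R\<lparr>carrier := F\<rparr>" by (rule subring_is_domain[OF F])
  interpret p: primeideal \<pp> "R\<lparr>carrier := F\<rparr>" using \<pp> by (simp add: F_def)
  have pF: "\<pp> \<subseteq> F" using p.a_subset by simp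
  have one_notin: "\<one> \<notin> \<pp>" using p.one_imp_carrier p.I_notcarr by auto
  have prime: "x \<in> \<pp> \<or> y \<in> \<pp>" if "x \<in> F" "y \<in> F" "x \<otimes> y \<in> \<pp>" for x y
    using p.I_prime[of x y] that by simp
  have zero: "\<zero> \<in> \<pp>" using p.zero_closed by simp
  have "ideal {\<zero>} R" by (rule zeroideal)
  then obtain P where P: "primeideal P R" "P \<inter> (F - \<pp>) = {}"
    and gen: "\<And>a. a \<in> carrier R \<Longrightarrow> a \<notin> P \<Longrightarrow> \<exists>q\<in>P. \<exists>r\<in>carrier R. q \<oplus> a \<otimes> r \<in> F - \<pp>"
  proof (rule exists_prime_avoiding[where M = "F - \<pp>"])
    show "x \<otimes> y \<in> F - \<pp>" if "x \<in> F - \<pp>" "y \<in> F - \<pp>" for x y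
      using that prime subringE(6)[OF F] by blast
  qed (use zero one_notin Fsub subringE(3)[OF F] in auto)
  interpret P: primeideal P R by (fact P(1))
  have "a \<in> P" if a: "a \<in> \<pp>" for a
  proof (rule ccontr)
    assume aP: "a \<notin> P"
    have aF: "a \<in> F" and aR: "a \<in> carrier R" using a pF Fsub by auto
    have a0: "a \<noteq> \<zero>" using aP P.zero_closed by auto
    from gen[OF aR aP] obtain q r where
      q: "q \<in> P" and r: "r \<in> carrier R" and s: "q \<oplus> a \<otimes> r \<in> F - \<pp>" by blast
    define s where "s = q \<oplus> a \<otimes> r"
    have qR: "q \<in> carrier R" using q P.a_subset by auto
    have sF: "s \<in> F" "s \<notin> \<pp>" and sR: "s \<in> carrier R" using s Fsub by (auto simp: s_def)
    have "s \<oplus> a \<otimes> (\<ominus> r) = q" using qR aR r unfolding s_def by algebra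
    with q have sP: "s \<oplus> a \<otimes> (\<ominus> r) \<in> P" by simp
    from fin[of "\<ominus> r"] r obtain A where A: "finite A" "A \<subseteq> carrier R" "\<ominus> r \<in> A"
      and stable: "\<And>\<sigma>. \<sigma> \<in> G \<Longrightarrow> \<sigma> ` A \<subseteq> A" by auto
    define N where "N = (\<Otimes>t\<in>A. s \<oplus> a \<otimes> t)"
    have NR: "N \<in> carrier R" unfolding N_def using A sR aR by (intro finprod_closed) auto
    have NF: "N \<in> F"
      using NR finprod_stable_set_invariant[OF hom inj A(1,2) stable sR _ aR] sF aF
      by (simp add: F_def fixed_points_def N_def)
    have "N \<in> P" unfolding N_def
      by (rule finprod_in_ideal[OF P.is_ideal A(1,3)]) (use A sR aR sP in auto)
    with NF P(2) have Np: "N \<in> \<pp>" by blast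
    obtain c where c: "c \<in> carrier R" and N: "N = s [^] card A \<oplus> a \<otimes> c"
      using finprod_add_mult_const[OF A(1,2) sR aR] by (auto simp: N_def)
    have pow: "s [^] (n::nat) \<in> F" for n
      by (induction n) (use sF subringE(3,6)[OF F] in auto)
    have pow_notin: "s [^] (n::nat) \<notin> \<pp>" for n
      by (induction n) (use one_notin sF prime pow in auto)
    have "a \<otimes> c = N \<oplus> (\<ominus> (s [^] card A))"
      using c NR aR sR nat_pow_closed[OF sR, of "card A"] unfolding N by algebra
    then have acF: "a \<otimes> c \<in> F"
      using NF pow subringE(5,7)[OF F] by simp
    have "\<sigma> c = c" if "\<sigma> \<in> G" for \<sigma>
    proof -
      have "\<sigma> c \<in> carrier R" using hom[OF that] c by (rule ring_hom_closed)
      moreover have "a \<otimes> \<sigma> c = a \<otimes> c"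
      proof -
        have "\<sigma> (a \<otimes> c) = a \<otimes> c" "\<sigma> a = a"
          using acF aF that unfolding F_def fixed_points_def by blast+
        then show ?thesis using ring_hom_mult[OF hom[OF that] aR c] by simp
      qed
      ultimately show ?thesis using m_lcancel[OF a0 aR] c by blast
    qed
    then have "c \<in> F" using c by (simp add: F_def fixed_points_def)
    then have acp: "a \<otimes> c \<in> \<pp>" using p.I_r_closed[OF a] by simp
    \<comment> \<open>Subtraction via \<open>\<ominus> \<one> \<in> F\<close>: negation in the ring \<open>F\<close> is a different term from negation in \<open>R\<close>.\<close>
    have "\<ominus> \<one> \<in> F" using subringE(3,5)[OF F] by blast
    then have "(a \<otimes> c) \<otimes> (\<ominus> \<one>) \<in> \<pp>" using p.I_r_closed[OF acp] by simp
    then have "N \<oplus> (a \<otimes> c) \<otimes> (\<ominus> \<one>) \<in> \<pp>" using p.a_closed[OF Np] by simp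
    moreover have "N \<oplus> (a \<otimes> c) \<otimes> (\<ominus> \<one>) = s [^] card A"
      using c aR nat_pow_closed[OF sR, of "card A"] unfolding N by algebra
    ultimately show False using pow_notin by simp
  qed
  with P(2) pF have "P \<inter> F = \<pp>" by blast
  with P(1) show thesis unfolding F_def by (rule that)
qed

section \<open>Strong extensions\<close>

lemma finite_stable_set_orbit:
  fixes S :: "('a, 'b) ring_scheme"
  assumes G: "subgroup G (RingAutoGroup S)"
    and fin: "locally_finite_action G (carrier S)"
    and R: "R \<subseteq> carrier S" "\<And>\<sigma>. \<sigma> \<in> G \<Longrightarrow> \<sigma> ` R \<subseteq> R"
    and r: "r \<in> R"
  shows "\<exists>A. finite A \<and> A \<subseteq> R \<and> r \<in> A \<and> (\<forall>\<sigma>\<in>G. \<sigma> ` A \<subseteq> A)"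
proof (intro exI conjI ballI)
  let ?A = "{\<sigma> r | \<sigma>. \<sigma> \<in> G}"
  have rS: "r \<in> carrier S" using r R by auto
  show "finite ?A" using fin rS by (auto simp: locally_finite_action_def)
  show "?A \<subseteq> R" using R(2) r by auto
  have "(\<lambda>x\<in>carrier S. x) \<in> G"
    using subgroup.one_closed[OF G] by (simp add: RingAutoGroup_def BijGroup_def)
  then show "r \<in> ?A" using rS by (auto intro!: exI[of _ "\<lambda>x\<in>carrier S. x"])
  have GS: "G \<subseteq> ring_auto S"
    using subgroup.subset[OF G] by (simp add: RingAutoGroup_def)
  fix \<sigma> assume \<sigma>: "\<sigma> \<in> G"
  show "\<sigma> ` ?A \<subseteq> ?A"
  proof clarify
    fix \<tau> assume \<tau>: "\<tau> \<in> G"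
    have "\<sigma> \<in> Bij (carrier S)" "\<tau> \<in> Bij (carrier S)"
      using GS \<sigma> \<tau> by (auto simp: ring_auto_def ring_iso_def Bij_def)
    then have "compose (carrier S) \<sigma> \<tau> \<in> G"
      using subgroup.m_closed[OF G \<sigma> \<tau>] by (simp add: RingAutoGroup_def BijGroup_def)
    then show "\<exists>\<rho>. \<sigma> (\<tau> r) = \<rho> r \<and> \<rho> \<in> G"
      using rS by (auto intro!: exI[of _ "compose (carrier S) \<sigma> \<tau>"] simp: compose_eq)
  qed
qed

theorem proposition2p9p1:
  fixes S :: "('a, 'b) ring_scheme"
    and R :: "'a set"
    and G :: "('a \<Rightarrow> 'a) set"
  assumes "domain S"
    and "subring R S"
    and "subgroup G (RingAutoGroup S)"
    and "locally_finite_action G (carrier S)"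
    and "\<And>\<sigma>. \<sigma> \<in> G \<Longrightarrow> \<sigma> ` R \<subseteq> R"
    and "strong_extension R S"
  shows "strong_extension (fixed_points G R) (S\<lparr>carrier := fixed_points G (carrier S)\<rparr>)"
proof -
  interpret S: domain S by fact
  note Rsub = subringE(1)[OF assms(2)]
  let ?R = "S\<lparr>carrier := R\<rparr>" and ?SG = "fixed_points G (carrier S)" and ?RG = "fixed_points G R"
  interpret R: domain ?R by (rule S.subring_is_domain[OF assms(2)])
  have iso: "\<sigma> \<in> ring_iso S S" if "\<sigma> \<in> G" for \<sigma>
    using subgroup.subset[OF assms(3)] that by (auto simp: RingAutoGroup_def ring_auto_def)
  then have homS: "\<sigma> \<in> ring_hom S S" and injS: "inj_on \<sigma> (carrier S)" if "\<sigma> \<in> G" for \<sigma>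
    using that by (auto simp: ring_iso_def bij_betw_def)
  have homR: "\<sigma> \<in> ring_hom ?R ?R" if "\<sigma> \<in> G" for \<sigma>
    using homS[OF that] assms(5)[OF that] Rsub by (auto simp: ring_hom_def subset_iff)
  have injR: "inj_on \<sigma> R" if "\<sigma> \<in> G" for \<sigma>
    using inj_on_subset[OF injS[OF that] Rsub] .
  have SG: "subring ?SG S" by (rule S.subring_fixed_points) (rule homS)
  interpret SG: domain "S\<lparr>carrier := ?SG\<rparr>" by (rule S.subring_is_domain[OF SG])
  have RG_eq: "?RG = R \<inter> ?SG" using Rsub by (auto simp: fixed_points_def)
  have "subring ?RG ?R" using R.subring_fixed_points[of G] homR by simp
  from R.subring_is_ring[OF this] have "ring (S\<lparr>carrier := ?RG\<rparr>)" by simp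
  then have RG: "subring ?RG (S\<lparr>carrier := ?SG\<rparr>)"
    using SG.subring_iff[of ?RG] by (simp add: RG_eq)
  have "strong_prime \<pp> ?RG (S\<lparr>carrier := ?SG\<rparr>)"
    if p: "primeideal \<pp> (S\<lparr>carrier := ?RG\<rparr>)" for \<pp>
  proof -
    obtain P where P: "primeideal P ?R" "P \<inter> ?RG = \<pp>"
      using R.lying_over_fixed_points[of G \<pp>] homR injR p
        finite_stable_set_orbit[OF assms(3,4) Rsub assms(5)] by auto
    have PR: "P \<subseteq> R"
      using additive_subgroup.a_subset[OF ideal.axioms(1)[OF primeideal.axioms(1)[OF P(1)]]] by simp
    have "strong_prime P R S" using assms(6) P(1) by (simp add: strong_extension_def)
    then have strong: "x \<in> P \<or> y \<in> P"
      if "x \<in> carrier S" "y \<in> carrier S" "x \<otimes>\<^bsub>S\<^esub> y \<in> P" for x y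
      using that by (auto simp: strong_prime_def)
    have "x \<in> \<pp> \<or> y \<in> \<pp>" if "x \<in> ?SG" "y \<in> ?SG" "x \<otimes>\<^bsub>S\<^esub> y \<in> \<pp>" for x y
    proof -
      have "x \<in> P \<or> y \<in> P"
        using that P(2) by (intro strong) (auto simp: fixed_points_def)
      with that PR P(2) show ?thesis by (auto simp: RG_eq)
    qed
    with p show ?thesis by (simp add: strong_prime_def)
  qed
  with RG SG.domain_axioms show ?thesis by (simp add: strong_extension_def)
qed

end
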